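(* Let $n$ and $k$ be integers with $0<k<n$, and let $d_n^k$ denote the number of permutations of $[n]$ that avoid all the substrings $j(j+k)$, $1\leq j\leq n-k$. Then $$d_n^k=\sum_{j=0}^{n-k}(-1)^j\binom{n-k}{j}(n-j)!.$$
   Context: $[n]=\{1,2,\ldots,n\}$. Permutations of $[n]$ are written in one-line notation $a_1a_2\cdots a_n$. A permutation avoids the substring $ab$ (with $a,b\in[n]$) if there is no index $i$, $1\leq i\leq n-1$, with $a_i=a$ and $a_{i+1}=b$; that is, $a$ is never immediately followed by $b$. In $d_n^k$ the superscript $k$ is an index, not an exponent. *)

theory Defs
  imports Main "HOL-Combinatorics.Multiset_Permutations"
begin

(* A permutation of [n] in one-line notation a_1 ... a_n is a list in
   permutations_of_set {1..n}; list positions are 0-based, so xs ! i is a_(i+1). *)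

definition avoids_substring :: "'a \<Rightarrow> 'a \<Rightarrow> 'a list \<Rightarrow> bool" where
  "avoids_substring a b xs \<longleftrightarrow>
     \<not> (\<exists>i. i + 1 < length xs \<and> xs ! i = a \<and> xs ! (i + 1) = b)"

definition d :: "nat \<Rightarrow> nat \<Rightarrow> nat" where
  "d n k = card {xs \<in> permutations_of_set {1..n}.
                   \<forall>j\<in>{1..n - k}. avoids_substring j (j + k) xs}"

end

theory Submission
  imports Defs
begin

text \<open>
  The formula is inclusion-exclusion over the set of forbidden substrings that a permutation
  does contain. What makes it collapse to a sum over cardinalities is that the number of
  permutations containing prescribed substrings \<open>j (j + k)\<close>, for all \<open>j\<close> in a set \<open>S\<close>, depends
  only on the size of \<open>S\<close>: it is \<open>(n - card S)!\<close> (lemma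
  \<open>card_permutations_containing\<close>).

  Heuristically, each prescribed substring glues two letters together, so that \<open>n - card S\<close>
  blocks remain to be arranged. To avoid handling blocks, the letters are removed one by one.
  If \<open>m\<close> is the largest element of \<open>S\<close>, then the letter \<open>m + k\<close> is neither the first letter of a
  prescribed substring nor the second letter of a prescribed substring other than \<open>m (m + k)\<close>.
  Its place is forced, directly behind \<open>m\<close>, and deleting it loses no information and leaves all
  other prescribed substrings intact. Hence each deletion lowers both the number of letters and
  the number of substrings by one, without changing the count.
\<close>

section \<open>Substrings of length two\<close>

lemma not_avoids_substring_iff:
  "\<not> avoids_substring a b xs \<longleftrightarrow> (\<exists>us vs. xs = us @ a # b # vs)"
proof
  assume "\<not> avoids_substring a b xs"
  then obtain i where i: "i + 1 < length xs" "xs ! i = a" "xs ! (i + 1) = b"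
    by (auto simp: avoids_substring_def)
  then have "xs = take i xs @ a # b # drop (i + 2) xs"
    by (metis Cons_nth_drop_Suc Suc_eq_plus1 Suc_lessD add_2_eq_Suc' append_take_drop_id)
  then show "\<exists>us vs. xs = us @ a # b # vs" by blast
next
  assume "\<exists>us vs. xs = us @ a # b # vs"
  then obtain us vs where "xs = us @ a # b # vs" by blast
  then have "length us + 1 < length xs \<and> xs ! length us = a \<and> xs ! (length us + 1) = b"
    by (simp add: nth_append)
  then show "\<not> avoids_substring a b xs"
    unfolding avoids_substring_def by blast
qed

lemma not_avoids_substring_Cons:
  "\<not> avoids_substring c e (x # xs) \<longleftrightarrow>
     x = c \<and> xs \<noteq> [] \<and> hd xs = e \<or> \<not> avoids_substring c e xs"
  unfolding not_avoids_substring_iff Cons_eq_append_conv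
  by (cases xs) auto

text \<open>
  Inserting \<open>b\<close> directly behind \<open>m\<close> can only destroy a substring starting with \<open>m\<close>, and can
  only create substrings that involve \<open>b\<close>.
\<close>
lemma avoids_substring_insert_behind:
  assumes "c \<noteq> m" "c \<noteq> b" "e \<noteq> b"
  shows "avoids_substring c e (us @ m # b # vs) \<longleftrightarrow> avoids_substring c e (us @ m # vs)"
proof -
  have "\<not> avoids_substring c e (us @ m # b # vs) \<longleftrightarrow> \<not> avoids_substring c e (us @ m # vs)"
  proof (induction us)
    case Nil
    show ?case using assms by (simp add: not_avoids_substring_Cons)
  next
    case (Cons u us)
    have "hd (us @ m # b # vs) = hd (us @ m # vs)" by (cases us) auto
    then show ?case using Cons by (simp add: not_avoids_substring_Cons)
  qed
  then show ?thesis by blast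
qed

section \<open>Permutations containing prescribed substrings\<close>

text \<open>
  Deleting \<open>b\<close> is the bijection behind the count: its inverse puts \<open>b\<close> back directly behind \<open>m\<close>.
  The side conditions on \<open>S\<close> and \<open>f\<close> keep the other prescribed substrings away from both
  letters, except that they may end in \<open>m\<close>; those survive, since \<open>b\<close> goes behind \<open>m\<close>.
\<close>
lemma card_permutations_delete_forced:
  assumes "m \<in> A" "b \<in> A" "m \<noteq> b"
    and S: "m \<notin> S" "b \<notin> S" "b \<notin> f ` S"
  shows "card {xs \<in> permutations_of_set A.
            \<not> avoids_substring m b xs \<and> (\<forall>j\<in>S. \<not> avoids_substring j (f j) xs)}
       = card {ys \<in> permutations_of_set (A - {b}). \<forall>j\<in>S. \<not> avoids_substring j (f j) ys}"
    (is "card ?X = card ?Y")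
proof (rule bij_betw_same_card)
  have keep: "(\<forall>j\<in>S. \<not> avoids_substring j (f j) (us @ m # b # vs)) \<longleftrightarrow>
              (\<forall>j\<in>S. \<not> avoids_substring j (f j) (us @ m # vs))" for us vs
  proof (rule ball_cong[OF refl])
    fix j assume "j \<in> S"
    then have "j \<noteq> m" "j \<noteq> b" "f j \<noteq> b" using S by auto
    then show "(\<not> avoids_substring j (f j) (us @ m # b # vs)) \<longleftrightarrow>
               (\<not> avoids_substring j (f j) (us @ m # vs))"
      by (simp add: avoids_substring_insert_behind)
  qed
  have split: "\<exists>us vs. xs = us @ m # b # vs \<and> removeAll b xs = us @ m # vs \<and>
                 m \<notin> set us \<and> m \<notin> set vs"
    if xs: "xs \<in> ?X" for xs
  proof -
    from xs obtain us vs where eq: "xs = us @ m # b # vs"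
      by (auto simp: not_avoids_substring_iff)
    moreover have "distinct xs" using xs by (auto simp: permutations_of_set_def)
    ultimately show ?thesis using \<open>m \<noteq> b\<close> by (intro exI[of _ us] exI[of _ vs]) auto
  qed
  show "bij_betw (removeAll b) ?X ?Y"
  proof (rule bij_betw_imageI)
    show "inj_on (removeAll b) ?X"
    proof (rule inj_onI)
      fix xs xs' assume X: "xs \<in> ?X" "xs' \<in> ?X" and eq: "removeAll b xs = removeAll b xs'"
      obtain us vs where 1: "xs = us @ m # b # vs" "removeAll b xs = us @ m # vs"
        "m \<notin> set us" "m \<notin> set vs"
        using split[OF X(1)] by blast
      obtain us' vs' where 2: "xs' = us' @ m # b # vs'" "removeAll b xs' = us' @ m # vs'"
        using split[OF X(2)] by blast
      have "us @ m # vs = us' @ m # vs'" using eq 1(2) 2(2) by simp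
      then have "us = us' \<and> vs = vs'"
        using 1(3,4) by (simp add: append_Cons_eq_iff)
      then show "xs = xs'" using 1(1) 2(1) by simp
    qed
    show "removeAll b ` ?X = ?Y"
    proof (intro subset_antisym subsetI)
      fix ys assume "ys \<in> removeAll b ` ?X"
      then obtain xs where xs: "xs \<in> ?X" and ys: "ys = removeAll b xs" by blast
      obtain us vs where 1: "xs = us @ m # b # vs" "removeAll b xs = us @ m # vs"
        using split[OF xs] by blast
      have "ys \<in> permutations_of_set (A - {b})"
        using xs by (auto simp: ys permutations_of_set_def distinct_removeAll)
      moreover have "\<forall>j\<in>S. \<not> avoids_substring j (f j) ys"
        unfolding ys 1(2) using xs keep[of us vs] 1(1) by blast
      ultimately show "ys \<in> ?Y" by simp
    next
      fix ys assume ys: "ys \<in> ?Y"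
      then have set_ys: "set ys = A - {b}" and "distinct ys"
        by (auto simp: permutations_of_set_def)
      then obtain us vs where eq: "ys = us @ m # vs"
        using \<open>m \<in> A\<close> \<open>m \<noteq> b\<close> split_list[of m ys] by auto
      let ?xs = "us @ m # b # vs"
      have b: "b \<notin> set us" "b \<notin> set vs" using set_ys eq by auto
      have "set ?xs = A" using set_ys eq \<open>b \<in> A\<close> by auto
      moreover have "distinct ?xs" using \<open>distinct ys\<close> eq b \<open>m \<noteq> b\<close> by auto
      moreover have "\<not> avoids_substring m b ?xs" by (auto simp: not_avoids_substring_iff)
      ultimately have "?xs \<in> ?X"
        using ys keep[of us vs] by (simp add: permutations_of_set_def eq)
      moreover have "ys = removeAll b ?xs" using b \<open>m \<noteq> b\<close> by (simp add: eq)
      ultimately show "ys \<in> removeAll b ` ?X" by blast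
    qed
  qed
qed

text \<open>
  Injectivity of \<open>f\<close> rules out two prescribed predecessors of one letter, and \<open>j < f j\<close> rules out
  prescribed cycles; both would make the count zero. The induction adds the elements of \<open>S\<close> in
  increasing order, so that the second letter of the newest substring lies above all of \<open>S\<close>.
\<close>
lemma card_permutations_containing:
  fixes A S :: "'a :: linorder set"
  assumes "finite A" "S \<subseteq> A" "f ` S \<subseteq> A" "inj_on f S" "\<And>j. j \<in> S \<Longrightarrow> j < f j"
  shows "card {xs \<in> permutations_of_set A. \<forall>j\<in>S. \<not> avoids_substring j (f j) xs}
       = fact (card A - card S)"
proof -
  have "finite S" using assms(1,2) by (rule rev_finite_subset)
  then show ?thesis using assms
  proof (induction S arbitrary: A rule: finite_linorder_max_induct)
    case empty
    then show ?case by simp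
  next
    case (insert m S)
    have less: "j < f m" if "j \<in> S" for j
      using insert.hyps(2) insert.prems(5)[of m] that by force
    have "f m \<notin> f ` S" using insert.hyps(2) insert.prems(4) by (auto simp: inj_on_def)
    have "card {xs \<in> permutations_of_set A. \<forall>j\<in>insert m S. \<not> avoids_substring j (f j) xs}
        = card {xs \<in> permutations_of_set (A - {f m}). \<forall>j\<in>S. \<not> avoids_substring j (f j) xs}"
      unfolding ball_simps
    proof (rule card_permutations_delete_forced)
      show "m \<noteq> f m" using insert.prems(5)[of m] by auto
    qed (use insert.prems insert.hyps less \<open>f m \<notin> f ` S\<close> in auto)
    also have "\<dots> = fact (card (A - {f m}) - card S)"
    proof (rule insert.IH)
      show "S \<subseteq> A - {f m}" using insert.prems(2) less by auto
      show "f ` S \<subseteq> A - {f m}" using insert.prems(3) \<open>f m \<notin> f ` S\<close> by blast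
    qed (use insert.prems in auto)
    also have "card (A - {f m}) - card S = card A - card (insert m S)"
      using insert.prems insert.hyps by auto
    finally show ?case .
  qed
qed

section \<open>Inclusion-exclusion\<close>

text \<open>
  This sieve form comes from expanding, for each \<open>x\<close>, the product over \<open>j\<close> of
  \<open>1 - of_bool (P j x)\<close>, which is the indicator of satisfying no \<open>P j\<close>.
\<close>
lemma card_satisfying_none:
  assumes "finite X" "finite J"
  shows "int (card {x \<in> X. \<forall>j\<in>J. \<not> P j x})
       = (\<Sum>S\<in>Pow J. (- 1) ^ card S * int (card {x \<in> X. \<forall>j\<in>S. P j x}))"
proof -
  have ind: "(\<Prod>j\<in>S. of_bool (Q j)) = (of_bool (\<forall>j\<in>S. Q j) :: int)" if "finite S" for S Q
    using that by (induction S) auto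
  have count: "int (card {x \<in> X. R x}) = (\<Sum>x\<in>X. of_bool (R x))" for R
    using \<open>finite X\<close> by (simp add: Int_def)
  have "int (card {x \<in> X. \<forall>j\<in>J. \<not> P j x}) = (\<Sum>x\<in>X. \<Prod>j\<in>J. 1 - of_bool (P j x))"
    using \<open>finite J\<close> by (simp add: count ind flip: of_bool_not_iff)
  also have "\<dots> = (\<Sum>x\<in>X. \<Sum>S\<in>Pow J. (- 1) ^ card S * of_bool (\<forall>j\<in>S. P j x))"
    using \<open>finite J\<close>
    by (intro sum.cong refl, subst prod_diff_conv_sum)
       (auto intro!: sum.cong simp: ind finite_subset)
  also have "\<dots> = (\<Sum>S\<in>Pow J. (- 1) ^ card S * int (card {x \<in> X. \<forall>j\<in>S. P j x}))"
    by (subst sum.swap) (simp only: count sum_distrib_left)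
  finally show ?thesis .
qed

lemma sum_Pow_card:
  fixes g :: "nat \<Rightarrow> 'a :: comm_semiring_1"
  assumes "finite J"
  shows "(\<Sum>S\<in>Pow J. g (card S)) = (\<Sum>i=0..card J. of_nat (card J choose i) * g i)"
proof -
  have "(\<Sum>S\<in>Pow J. g (card S)) = (\<Sum>i=0..card J. \<Sum>S | S \<in> Pow J \<and> card S = i. g (card S))"
    using assms by (intro sum.group[symmetric]) (auto intro: card_mono)
  also have "\<dots> = (\<Sum>i=0..card J. of_nat (card J choose i) * g i)"
    using n_subsets[OF assms] by (intro sum.cong) auto
  finally show ?thesis .
qed

theorem proposition2p1:
  fixes n k :: nat
  assumes "0 < k" and "k < n"
  shows "int (d n k) =
    (\<Sum>j = 0..n - k. (-1) ^ j * int ((n - k) choose j) * int (fact (n - j)))"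
proof -
  have containing: "card {xs \<in> permutations_of_set {1..n}.
                       \<forall>j\<in>S. \<not> avoids_substring j (j + k) xs} = fact (n - card S)"
    if "S \<in> Pow {1..n - k}" for S
  proof (subst card_permutations_containing)
    show "S \<subseteq> {1..n}" using that by force
    show "(\<lambda>j. j + k) ` S \<subseteq> {1..n}" using that \<open>k < n\<close> by fastforce
  qed (use \<open>0 < k\<close> in \<open>auto simp: inj_on_def\<close>)
  have "int (d n k) = (\<Sum>S\<in>Pow {1..n - k}. (- 1) ^ card S *
          int (card {xs \<in> permutations_of_set {1..n}.
            \<forall>j\<in>S. \<not> avoids_substring j (j + k) xs}))"
    using card_satisfying_none[of "permutations_of_set {1..n}" "{1..n - k}"
        "\<lambda>j xs. \<not> avoids_substring j (j + k) xs"]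
    by (simp add: d_def)
  also have "\<dots> = (\<Sum>S\<in>Pow {1..n - k}. (- 1) ^ card S * int (fact (n - card S)))"
    by (intro sum.cong refl) (simp only: containing)
  also have "\<dots> = (\<Sum>j = 0..n - k. int ((n - k) choose j) * ((- 1) ^ j * int (fact (n - j))))"
    by (subst sum_Pow_card[where g = "\<lambda>i. (- 1) ^ i * int (fact (n - i))"]) simp_all
  finally show ?thesis by (simp only: mult_ac)
qed

end
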